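(* Let $s\ge2$ and let $r,k,a$ be integers satisfying $1\le a\le k<r$ and $sk\le r$. Then $$\pi\bigl(T^r_{a,[k,s]}\bigr)\le\frac{M(r,k,s-1)}{\binom rk}.$$
   Context: Write $[q]=\{1,\dots,q\}$. For $r\ge2$, an $r$-graph is a family of $r$-subsets (edges) of a vertex set; $|H|$ is the number of edges of $H$. For an $r$-graph $F$, $H$ is $F$-free if it does not contain $F$ as a (not necessarily induced) subgraph; $\mathrm{ex}(n,F)=\max\{|H|: |V(H)|=n,\ H\text{ is }F\text{-free}\}$, and the Turán density is $\pi(F)=\lim_{n\to\infty}\mathrm{ex}(n,F)/\binom nr$. A partial hypergraph is a finite vertex set together with a finite collection $e_1,\dots,e_t$ of subsets of it (partial edges, not necessarily of the same size). If all $|e_j|\le r$, its $r$-uniform extension is the $r$-graph obtained by adding, for each $j\in[t]$, a private set $U_j$ of $r-|e_j|$ new vertices (the $U_j$ pairwise disjoint) and taking as edges the sets $e_j\cup U_j$, $j\in[t]$. Definition of $T^r_{a,[k,s]}$ (here $[k,s]$ is just part of the notation): choose disjoint sets $A,E$ with $|A|=a$, $|E|=r$, and pairwise disjoint $B_1,\dots,B_s\subseteq E$ with $|B_i|=k$ for every $i$; put $\bar B_i=E\setminus B_i$. Then $T^r_{a,[k,s]}$ is the $r$-uniform extension of the partial hypergraph on $A\cup E$ with partial edges $E, A\cup\bar B_1,\dots,A\cup\bar B_s$. $M(r,k,s-1)=\max\{|\mathcal B|:\mathcal B\subseteq\binom{[r]}{k},\ \nu(\mathcal B)\le s-1\}$,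 where $\nu(\mathcal B)$ is the matching number, i.e. the maximum number of pairwise disjoint members of $\mathcal B$. *)

theory Defs
  imports
    Complex_Main
    "HOL-Library.Ramsey"
    "HOL-Library.Disjoint_Sets"
begin

type_synonym 'v hypergraph = "'v set \<times> 'v set set"

abbreviation verts :: "'v hypergraph \<Rightarrow> 'v set" where "verts \<equiv> fst"
abbreviation edges :: "'v hypergraph \<Rightarrow> 'v set set" where "edges \<equiv> snd"

definition r_graph :: "nat \<Rightarrow> 'v hypergraph \<Rightarrow> bool" where
  "r_graph r H \<longleftrightarrow> finite (verts H) \<and> edges H \<subseteq> nsets (verts H) r"

definition contains_copy :: "'w hypergraph \<Rightarrow> 'v hypergraph \<Rightarrow> bool" where
  "contains_copy H F \<longleftrightarrow>
     (\<exists>f. inj_on f (verts F) \<and> f ` verts F \<subseteq> verts H \<and> (\<forall>e\<in>edges F. f ` e \<in> edges H))"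

definition free_of :: "'v hypergraph \<Rightarrow> 'w hypergraph \<Rightarrow> bool" where
  "free_of F H \<longleftrightarrow> \<not> contains_copy H F"

text \<open>The host graphs have vertices in \<^typ>\<open>nat\<close>; every finite hypergraph is isomorphic to
  such a one. The uniformity \<open>r\<close> is a separate argument, since an edgeless \<open>F\<close> does not
  determine it.\<close>

definition turan_number :: "nat \<Rightarrow> nat \<Rightarrow> 'v hypergraph \<Rightarrow> nat" where
  "turan_number r n F =
     Max {card (edges H) | H :: nat hypergraph. r_graph r H \<and> card (verts H) = n \<and> free_of F H}"

definition turan_density :: "nat \<Rightarrow> 'v hypergraph \<Rightarrow> real" where
  "turan_density r F = lim (\<lambda>n. real (turan_number r n F) / real (n choose r))"

definition partial_hypergraph :: "'v set \<Rightarrow> 'v set list \<Rightarrow> bool" where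
  "partial_hypergraph X es \<longleftrightarrow> finite X \<and> (\<forall>e\<in>set es. e \<subseteq> X)"

text \<open>The uniform extension is determined only up to the choice of the new vertices \<open>U j\<close>,
  so it is a relation between the partial hypergraph \<open>(X, es)\<close> and its extension.\<close>

definition is_uniform_extension ::
    "nat \<Rightarrow> 'v set \<Rightarrow> 'v set list \<Rightarrow> 'v hypergraph \<Rightarrow> bool" where
  "is_uniform_extension r X es F \<longleftrightarrow>
     partial_hypergraph X es \<and> (\<forall>e\<in>set es. card e \<le> r) \<and>
     (\<exists>U :: nat \<Rightarrow> 'v set.
        (\<forall>j<length es. finite (U j) \<and> card (U j) = r - card (es ! j) \<and> U j \<inter> X = {}) \<and>
        disjoint_family_on U {..<length es} \<and>
        verts F = X \<union> (\<Union>j<length es. U j) \<and>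
        edges F = (\<lambda>j. es ! j \<union> U j) ` {..<length es})"

text \<open>\<open>is_T r a k s F\<close> says that \<open>F\<close> is a realisation of \<open>T\<^sup>r\<close> with parameters
  \<open>a, [k, s]\<close>, for some choice of the sets involved.\<close>

definition is_T :: "nat \<Rightarrow> nat \<Rightarrow> nat \<Rightarrow> nat \<Rightarrow> 'v hypergraph \<Rightarrow> bool" where
  "is_T r a k s F \<longleftrightarrow>
     (\<exists>A E (B :: nat \<Rightarrow> 'v set).
        finite A \<and> card A = a \<and> finite E \<and> card E = r \<and> A \<inter> E = {} \<and>
        (\<forall>i\<in>{1..s}. B i \<subseteq> E \<and> card (B i) = k) \<and> disjoint_family_on B {1..s} \<and>
        is_uniform_extension r (A \<union> E) (E # map (\<lambda>i. A \<union> (E - B i)) [1..<Suc s]) F)"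

definition matching_number :: "'v set set \<Rightarrow> nat" where
  "matching_number \<B> = Max {card \<M> | \<M>. \<M> \<subseteq> \<B> \<and> disjoint \<M>}"

definition max_family :: "nat \<Rightarrow> nat \<Rightarrow> nat \<Rightarrow> nat" where
  "max_family r k m = Max {card \<B> | \<B>. \<B> \<subseteq> nsets {1..r} k \<and> matching_number \<B> \<le> m}"

text \<open>Realisations exist, so hypotheses of the form \<open>is_T r a k s F\<close> are not vacuous.\<close>

lemma is_T_exists:
  assumes "a \<le> k" "s * k \<le> r"
  shows "\<exists>F :: nat hypergraph. is_T r a k s F"
proof -
  define A where "A = {..<a}"
  define E where "E = {a..<a + r}"
  define B where "B = (\<lambda>i. {a + (i - 1) * k..<a + (i - 1) * k + k})"
  define es where "es = E # map (\<lambda>i. A \<union> (E - B i)) [1..<Suc s]"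
  define U where "U = (\<lambda>j. {a + r + j * r..<a + r + j * r + (r - card (es ! j))})"
  define F where "F = (A \<union> E \<union> (\<Union>j<length es. U j), (\<lambda>j. es ! j \<union> U j) ` {..<length es})"
  have step: "i * c + c \<le> j * c" if "i < j" for i j c :: nat
    using mult_le_mono1[of "Suc i" j c] that by simp
  have BE: "B i \<subseteq> E" if "i \<in> {1..s}" for i
  proof -
    have "(i - 1) * k + k \<le> s * k" using step[of "i - 1" s k] that by auto
    then show ?thesis using assms by (auto simp: B_def E_def)
  qed
  have cB: "card (B i) = k" for i by (simp add: B_def)
  have dB: "disjoint_family_on B {1..s}"
  proof -
    have "B i \<inter> B j = {}" if "i \<in> {1..s}" "i < j" for i j
      using step[of "i - 1" "j - 1" k] that by (fastforce simp: B_def)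
    then show ?thesis unfolding disjoint_family_on_def
      by (metis Int_commute nat_neq_iff)
  qed
  have dU: "disjoint_family_on U {..<length es}"
  proof -
    have "U i \<inter> U j = {}" if "i < j" for i j
      using step[of i j r] that by (fastforce simp: U_def)
    then show ?thesis unfolding disjoint_family_on_def
      by (metis Int_commute nat_neq_iff)
  qed
  have c: "card e \<le> r" if "e \<in> set es" for e
  proof -
    have "card (A \<union> (E - B i)) \<le> r" if "i \<in> {1..s}" for i
    proof -
      have "card (E - B i) = r - k"
        using BE[OF that] cB by (subst card_Diff_subset) (auto simp: E_def B_def)
      moreover have "k \<le> r" using card_mono[OF _ BE[OF that]] cB by (simp add: E_def)
      moreover have "card (A \<union> (E - B i)) \<le> a + card (E - B i)"
        using card_Un_le[of A "E - B i"] by (simp add: A_def)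
      ultimately show ?thesis using assms by simp
    qed
    with that show ?thesis by (auto simp: es_def E_def)
  qed
  have "is_uniform_extension r (A \<union> E) es F"
    unfolding is_uniform_extension_def partial_hypergraph_def
  proof (intro conjI exI[of _ U])
    show "\<forall>j<length es. finite (U j) \<and> card (U j) = r - card (es ! j) \<and> U j \<inter> (A \<union> E) = {}"
      by (auto simp: U_def A_def E_def)
  qed (use c dU in \<open>auto simp: es_def F_def A_def E_def\<close>)
  then have "is_T r a k s F"
    unfolding is_T_def es_def using BE cB dB
    by (intro exI[of _ A] exI[of _ E] exI[of _ B]) (auto simp: A_def E_def)
  then show ?thesis ..
qed

end

theory Submission
  imports Defs
begin

text \<open>
  Let \<open>H\<close> be \<open>F\<close>-free on \<open>n\<close> vertices and put \<open>M = M(r, k, s - 1)\<close>. Fix an edge \<open>E\<close>. If a \<open>k\<close>-set \<open>A\<close>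
  disjoint from \<open>E\<close> has more than \<open>M\<close> sets \<open>B \<subseteq> E\<close> of size \<open>k\<close> with \<open>A \<union> (E - B) \<in> H\<close>, then some
  \<open>s\<close> of these \<open>B\<close> are pairwise disjoint. There are boundedly many choices of these \<open>s\<close> sets, and the
  \<open>A\<close> belonging to one choice cannot contain a sunflower with \<open>s\<close> petals and a kernel of size \<open>a\<close>,
  as that would give a copy of \<open>F\<close>; so there are only \<open>O(n\<^sup>k\<^sup>-\<^sup>1)\<close> such \<open>A\<close>. Writing \<open>d(S)\<close> for the
  number of edges containing \<open>S\<close>, this bounds the sum of \<open>d(S)\<close> over the \<open>(r - k)\<close>-sets \<open>S \<subseteq> E\<close>
  by \<open>M (n choose k) + O(n\<^sup>k\<^sup>-\<^sup>1)\<close>. Summing over \<open>E\<close> gives the sum of \<open>d(S)\<^sup>2\<close> over all \<open>S\<close>, which by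
  Cauchy--Schwarz is at least \<open>(|H| (r choose k))\<^sup>2 / (n choose (r - k))\<close>.
\<close>

subsection \<open>Matchings and sunflowers\<close>

lemma card_nsets: "finite V \<Longrightarrow> card (nsets V k) = card V choose k"
  by (metis (no_types, lifting) Collect_cong finite_subset n_subsets nsets_def)

lemma binomial_le_power: "n choose k \<le> n ^ k"
  by (cases "k \<le> n") (simp_all add: binomial_le_pow binomial_eq_0)

text \<open>Such a set is fixed by one of its points in \<open>X\<close> together with its other
  \<open>k - 1\<close> points. For \<open>k = 0\<close> only the empty set is available, and it
  meets nothing.\<close>

lemma card_nsets_meeting:
  assumes "finite V" "finite X"
  shows "card {A \<in> nsets V k. A \<inter> X \<noteq> {}} \<le> card X * card V ^ (k - 1)"
proof -
  let ?N = "nsets V (k - 1)"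
  have fin: "finite ?N" by (simp add: assms finite_imp_finite_nsets)
  have "{A \<in> nsets V k. A \<inter> X \<noteq> {}} \<subseteq> (\<Union>x\<in>X. insert x ` ?N)"
  proof
    fix A assume "A \<in> {A \<in> nsets V k. A \<inter> X \<noteq> {}}"
    then obtain x where x: "x \<in> A" "x \<in> X" and A: "A \<in> nsets V k" by auto
    then have "A - {x} \<in> ?N" by (auto simp: nsets_def)
    with x show "A \<in> (\<Union>x\<in>X. insert x ` ?N)" by (metis UN_I imageI insert_Diff)
  qed
  then have "card {A \<in> nsets V k. A \<inter> X \<noteq> {}} \<le> card (\<Union>x\<in>X. insert x ` ?N)"
    using assms fin by (intro card_mono) auto
  also have "\<dots> \<le> (\<Sum>x\<in>X. card (insert x ` ?N))" by (rule card_UN_le) fact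
  also have "\<dots> \<le> (\<Sum>x\<in>X. card V ^ (k - 1))"
    by (intro sum_mono order.trans[OF card_image_le[OF fin]])
       (simp add: card_nsets assms binomial_le_power)
  finally show ?thesis by simp
qed

text \<open>Greedy choice: \<open>s\<close> members cover at most \<open>s * j\<close> points, so at
  most \<open>s * j * card V ^ (j - 1)\<close> members of \<open>L\<close> touch them, and a further
  disjoint member remains.\<close>

lemma large_imp_matching:
  assumes "finite V" "L \<subseteq> nsets V j" "0 < j" "s * j * card V ^ (j - 1) < card L"
  shows "\<exists>\<M>\<subseteq>L. disjoint \<M> \<and> card \<M> = s"
  using assms(4)
proof (induction s)
  case 0
  show ?case by (intro exI[of _ "{}"]) auto
next
  case (Suc s)
  have finL: "finite L"
    using assms finite_subset finite_imp_finite_nsets by blast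
  have "s * j * card V ^ (j - 1) < card L"
    by (rule le_less_trans[OF _ Suc.prems]) simp
  then obtain \<M> where M: "\<M> \<subseteq> L" "disjoint \<M>" "card \<M> = s" using Suc.IH by blast
  have fM: "finite \<M>" using finL M finite_subset by blast
  have el: "finite B \<and> card B = j" if "B \<in> L" for B
    using that assms by (auto simp: nsets_def)
  have fU: "finite (\<Union>\<M>)" using fM M el by auto
  have "card (\<Union>\<M>) \<le> (\<Sum>B\<in>\<M>. card B)"
    using card_UN_le[OF fM, of "\<lambda>x. x"] by simp
  also have "\<dots> = s * j" using M el by (simp add: subset_iff)
  finally have cU: "card (\<Union>\<M>) \<le> s * j" .
  have "card {B \<in> nsets V j. B \<inter> \<Union>\<M> \<noteq> {}} \<le> s * j * card V ^ (j - 1)"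
    using card_nsets_meeting[OF assms(1) fU, of j] cU by (meson le_trans mult_le_mono1)
  also have "\<dots> < card L"
    by (rule le_less_trans[OF _ Suc.prems]) simp
  finally have "\<not> L \<subseteq> {B \<in> nsets V j. B \<inter> \<Union>\<M> \<noteq> {}}"
    using card_mono[of "{B \<in> nsets V j. B \<inter> \<Union>\<M> \<noteq> {}}" L] assms(1)
    by (auto simp: finite_imp_finite_nsets not_le)
  then obtain B where B: "B \<in> L" "B \<inter> \<Union>\<M> = {}" using assms(2) by blast
  \<comment> \<open>An empty \<open>B\<close> would be disjoint from everything and might already
    lie in \<open>\<M>\<close>; \<open>0 < j\<close> excludes this.\<close>
  have "B \<noteq> {}" using el[OF B(1)] assms(3) by auto
  then have "B \<notin> \<M>" using B(2) by blast
  then have "card (insert B \<M>) = Suc s" using fM M by simp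
  moreover have "disjoint (insert B \<M>)"
    using M(2) B(2) by (auto simp: pairwise_insert disjnt_def)
  ultimately show ?case using B M by (intro exI[of _ "insert B \<M>"]) auto
qed

lemma disjoint_enumeration:
  assumes "disjoint \<M>" "finite \<M>" "card \<M> = s"
  obtains b where "bij_betw b {1..s} \<M>" "disjoint_family_on b {1..s}"
proof -
  from assms obtain b where b: "bij_betw b {1..s} \<M>"
    by (metis ex_bij_betw_nat_finite_1)
  then have "disjoint_family_on b {1..s}"
    using assms(1) unfolding disjoint_family_on_def bij_betw_def inj_on_def disjoint_def
    by (metis imageI)
  with b show thesis by (rule that)
qed

text \<open>Averaging over kernels: each member of \<open>G\<close> contains one of at most
  \<open>card V ^ a\<close> sets of size \<open>a\<close>, so some \<open>a\<close>-set lies in many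
  members. Removing it from these leaves sets of size \<open>k - a\<close>, and a matching among
  them supplies the petals.\<close>

lemma exists_sunflower_with_kernel:
  assumes V: "finite V" and G: "G \<subseteq> nsets V k" and ak: "a \<le> k"
    and large: "s * k * card V ^ (k - 1) < card G"
  shows "\<exists>A U. finite A \<and> card A = a \<and> A \<subseteq> V \<and> disjoint_family_on U {1..s} \<and>
           (\<forall>i\<in>{1..s::nat}. A \<union> U i \<in> G \<and> A \<inter> U i = {})"
proof (cases "a = k")
  case True
  \<comment> \<open>A single member of \<open>G\<close> is the kernel and all petals are empty; an
    indexed disjoint family may repeat the empty set.\<close>
  from large obtain A where "A \<in> G" by (metis card.empty equals0I not_less_zero)
  with G True show ?thesis
    by (intro exI[of _ A] exI[of _ "\<lambda>_. {}"]) (auto simp: nsets_def disjoint_family_on_def)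
next
  case False
  let ?N = "nsets V a" and ?j = "k - a"
  let ?c = "s * ?j * card V ^ (?j - 1)"
  have fG: "finite G" using V G finite_subset finite_imp_finite_nsets by blast
  have fN: "finite ?N" by (simp add: V finite_imp_finite_nsets)
  have "\<exists>A\<in>?N. ?c < card {B \<in> G. A \<subseteq> B}"
  proof (rule ccontr)
    assume "\<not> ?thesis"
    then have le: "card {B \<in> G. A \<subseteq> B} \<le> ?c" if "A \<in> ?N" for A
      using that by (auto simp: not_less)
    have "G \<subseteq> (\<Union>A\<in>?N. {B \<in> G. A \<subseteq> B})"
    proof
      fix B assume B: "B \<in> G"
      then have "a \<le> card B" using G ak by (auto simp: nsets_def)
      then obtain A where "A \<subseteq> B" "card A = a" "finite A" by (rule obtain_subset_with_card_n)
      moreover from this have "A \<in> ?N" using B G by (auto simp: nsets_def)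
      ultimately show "B \<in> (\<Union>A\<in>?N. {B \<in> G. A \<subseteq> B})" using B by blast
    qed
    then have "card G \<le> card (\<Union>A\<in>?N. {B \<in> G. A \<subseteq> B})"
      using fG fN by (intro card_mono) auto
    also have "\<dots> \<le> (\<Sum>A\<in>?N. card {B \<in> G. A \<subseteq> B})" by (rule card_UN_le) fact
    also have "\<dots> \<le> (\<Sum>A\<in>?N. ?c)" by (rule sum_mono) (rule le)
    also have "\<dots> = card ?N * ?c" by simp
    also have "\<dots> \<le> card V ^ a * ?c" by (intro mult_le_mono1) (simp add: card_nsets V binomial_le_power)
    also have "\<dots> = s * ?j * card V ^ (k - 1)"
      using False ak by (simp add: mult_ac flip: power_add)
    also have "\<dots> \<le> s * k * card V ^ (k - 1)" by simp
    finally show False using large by simp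
  qed
  then obtain A where A: "A \<in> ?N" "?c < card {B \<in> G. A \<subseteq> B}" by blast
  define L where "L = (\<lambda>B. B - A) ` {B \<in> G. A \<subseteq> B}"
  have "inj_on (\<lambda>B. B - A) {B \<in> G. A \<subseteq> B}" by (auto simp: inj_on_def)
  then have "?c < card L" using A by (simp add: L_def card_image)
  moreover have "L \<subseteq> nsets V ?j"
    using A G by (auto simp: L_def nsets_def card_Diff_subset)
  ultimately obtain \<M> where M: "\<M> \<subseteq> L" "disjoint \<M>" "card \<M> = s"
    using large_imp_matching[OF V, of L ?j s] False ak by auto
  have "finite \<M>" using M fG by (auto simp: L_def intro: finite_subset)
  then obtain U where U: "bij_betw U {1..s} \<M>" "disjoint_family_on U {1..s}"
    using disjoint_enumeration M by metis
  have "A \<union> U i \<in> G \<and> A \<inter> U i = {}" if "i \<in> {1..s}" for i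
  proof -
    have "U i \<in> L" using U(1) M(1) that by (auto simp: bij_betw_def)
    then obtain B where "B \<in> G" "A \<subseteq> B" "U i = B - A" by (auto simp: L_def)
    then show ?thesis by (auto simp: Un_absorb1)
  qed
  with A(1) U(2) show ?thesis
    by (intro exI[of _ A] exI[of _ U]) (auto simp: nsets_def)
qed

section \<open>Matching number and the extremal function \<open>max_family\<close>\<close>

lemma obtain_matching:
  assumes "finite \<B>" "m < matching_number \<B>"
  obtains \<M> where "\<M> \<subseteq> \<B>" "disjoint \<M>" "card \<M> = Suc m"
proof -
  let ?S = "{card \<M> | \<M>. \<M> \<subseteq> \<B> \<and> disjoint \<M>}"
  have "?S \<subseteq> card ` Pow \<B>" by auto
  then have "finite ?S" using assms(1) finite_subset by blast
  moreover have "?S \<noteq> {}" by (auto intro!: exI[of _ "{}"])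
  ultimately have "Max ?S \<in> ?S" by (rule Max_in)
  then obtain \<M> where M: "\<M> \<subseteq> \<B>" "disjoint \<M>" "matching_number \<B> = card \<M>"
    unfolding matching_number_def by auto
  then have "Suc m \<le> card \<M>" using assms by simp
  then obtain \<N> where "\<N> \<subseteq> \<M>" "card \<N> = Suc m" "finite \<N>" by (rule obtain_subset_with_card_n)
  with M show thesis by (intro that[of \<N>]) (auto intro: pairwise_subset)
qed

text \<open>\<open>max_family\<close> refers to the ground set \<open>{1..r}\<close>, so the family
  is carried there by a bijection \<open>g\<close>. Its size forces a matching number above
  \<open>m\<close>, and the matching is pulled back: sets with disjoint images are disjoint.\<close>

lemma max_family_less_imp_matching:
  assumes E: "finite E" "card E = r" and B: "\<B> \<subseteq> nsets E k" and large: "max_family r k m < card \<B>"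
  obtains \<M> where "\<M> \<subseteq> \<B>" "disjoint \<M>" "card \<M> = Suc m"
proof -
  from E obtain g where g: "bij_betw g E {1..r}"
    by (metis bij_betw_inv ex_bij_betw_nat_finite_1)
  have inj: "inj_on ((`) g) (Pow E)"
    using g by (simp add: bij_betw_def inj_on_image_Pow)
  have BP: "\<B> \<subseteq> Pow E" using B by (auto simp: nsets_def)
  let ?B = "(`) g ` \<B>"
  let ?S = "{card \<C> | \<C>. \<C> \<subseteq> nsets {1..r} k \<and> matching_number \<C> \<le> m}"
  have sub: "?B \<subseteq> nsets {1..r} k"
  proof
    fix X assume "X \<in> ?B"
    then obtain Y where Y: "Y \<in> \<B>" "X = g ` Y" by auto
    then have "Y \<subseteq> E" "finite Y" "card Y = k" using B by (auto simp: nsets_def)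
    moreover have "inj_on g Y" using g \<open>Y \<subseteq> E\<close> by (auto simp: bij_betw_def intro: inj_on_subset)
    ultimately show "X \<in> nsets {1..r} k"
      using Y g by (auto simp: nsets_def card_image bij_betw_def)
  qed
  have fS: "finite ?S"
  proof -
    have "?S \<subseteq> card ` Pow (nsets {1..r} k)" by auto
    then show ?thesis by (meson finite_surj finite_Pow_iff finite_atLeastAtMost finite_imp_finite_nsets)
  qed
  have cB: "card ?B = card \<B>" using inj BP by (meson card_image inj_on_subset)
  have "m < matching_number ?B"
  proof (rule ccontr)
    assume "\<not> ?thesis"
    then have "card ?B \<in> ?S" using sub by (intro CollectI exI[of _ ?B]) auto
    then have "card ?B \<le> max_family r k m"
      unfolding max_family_def using fS by (rule Max_ge[rotated])
    then show False using large cB by simp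
  qed
  moreover have "finite ?B" by (rule finite_subset[OF sub]) (simp add: finite_imp_finite_nsets)
  ultimately obtain \<N> where N: "\<N> \<subseteq> ?B" "disjoint \<N>" "card \<N> = Suc m"
    using obtain_matching by blast
  define \<M> where "\<M> = {X \<in> \<B>. g ` X \<in> \<N>}"
  have im: "(`) g ` \<M> = \<N>" using N(1) by (auto simp: \<M>_def)
  have "inj_on ((`) g) \<M>" using inj BP by (auto simp: \<M>_def intro: inj_on_subset)
  then have "card \<M> = Suc m" using im N(3) card_image by metis
  moreover have "disjoint \<M>"
  proof (rule disjointI)
    fix X Y assume XY: "X \<in> \<M>" "Y \<in> \<M>" "X \<noteq> Y"
    then have "g ` X \<noteq> g ` Y" using \<open>inj_on ((`) g) \<M>\<close> by (auto dest: inj_onD)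
    then have "g ` X \<inter> g ` Y = {}" using XY N(2) im by (metis disjointD imageI)
    then show "X \<inter> Y = {}" by auto
  qed
  ultimately show thesis by (intro that[of \<M>]) (auto simp: \<M>_def)
qed

subsection \<open>Convergence to the Turan density\<close>

text \<open>The hosts range over infinitely many vertex sets, but their edge counts never exceed
  \<open>n choose r\<close>. This makes the \<open>Max\<close> in \<open>turan_number\<close>
  meaningful.\<close>

lemma finite_turan_candidates:
  "finite {card (edges H) | H :: nat hypergraph. r_graph r H \<and> card (verts H) = n \<and> free_of F H}"
proof (rule finite_subset)
  show "{card (edges H) | H :: nat hypergraph. r_graph r H \<and> card (verts H) = n \<and> free_of F H}
          \<subseteq> {..n choose r}"
  proof
    fix m assume "m \<in> {card (edges H) | H :: nat hypergraph.
        r_graph r H \<and> card (verts H) = n \<and> free_of F H}"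
    then obtain H :: "nat hypergraph" where
      "m = card (edges H)" "n = card (verts H)" "r_graph r H" by blast
    moreover from this have fin: "finite (verts H)" and sub: "edges H \<subseteq> nsets (verts H) r"
      by (simp_all add: r_graph_def)
    from fin have "card (edges H) \<le> card (nsets (verts H) r)"
      by (intro card_mono sub finite_imp_finite_nsets)
    ultimately show "m \<in> {..n choose r}"
      by (simp add: card_nsets)
  qed
qed simp

lemma card_edges_le_turan_number:
  fixes H :: "nat hypergraph"
  assumes "r_graph r H" "card (verts H) = n" "free_of F H"
  shows "card (edges H) \<le> turan_number r n F"
  unfolding turan_number_def using assms by (intro Max_ge finite_turan_candidates) blast

lemma obtain_turan_extremal:
  assumes "edges F \<noteq> {}"
  obtains H :: "nat hypergraph"
  where "r_graph r H" "card (verts H) = n" "free_of F H" "card (edges H) = turan_number r n F"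
proof -
  let ?S = "{card (edges H) | H :: nat hypergraph. r_graph r H \<and> card (verts H) = n \<and> free_of F H}"
  \<comment> \<open>The edgeless host is \<open>F\<close>-free because \<open>F\<close> has an edge,
    so the maximum is over a nonempty set.\<close>
  have "card (edges ({..<n}, {})) \<in> ?S"
    using assms by (intro CollectI exI[of _ "({..<n}, {})"])
      (auto simp: r_graph_def free_of_def contains_copy_def)
  then have "Max ?S \<in> ?S" by (intro Max_in finite_turan_candidates) blast
  then show thesis using that unfolding turan_number_def by auto
qed

text \<open>Averaging over vertex deletions: deleting any one vertex from an extremal
  \<open>H\<close> on \<open>Suc n\<close> vertices leaves an \<open>F\<close>-free graph on
  \<open>n\<close> vertices.\<close>

lemma turan_number_Suc_le:
  assumes "edges F \<noteq> {}" "r \<le> n"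
  shows "(Suc n - r) * turan_number r (Suc n) F \<le> Suc n * turan_number r n F"
proof -
  obtain H :: "nat hypergraph" where H: "r_graph r H" "card (verts H) = Suc n" "free_of F H"
    "card (edges H) = turan_number r (Suc n) F"
    using obtain_turan_extremal[OF assms(1)] by blast
  let ?V = "verts H" and ?S = "edges H"
  have fV: "finite ?V" and S: "?S \<subseteq> nsets ?V r" using H by (auto simp: r_graph_def)
  have fS: "finite ?S" by (rule finite_subset[OF S]) (simp add: fV finite_imp_finite_nsets)
  have del: "card {e \<in> ?S. v \<notin> e} \<le> turan_number r n F" if "v \<in> ?V" for v
  proof -
    let ?H = "(?V - {v}, {e \<in> ?S. v \<notin> e})"
    have "r_graph r ?H" using S fV by (auto simp: r_graph_def nsets_def)
    moreover have "card (verts ?H) = n" using that H(2) by simp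
    moreover have "free_of F ?H"
      using H(3) unfolding free_of_def contains_copy_def by fastforce
    ultimately have "card (edges ?H) \<le> turan_number r n F" by (rule card_edges_le_turan_number)
    then show ?thesis by simp
  qed
  \<comment> \<open>Each edge survives the deletion of exactly \<open>Suc n - r\<close> of the vertices.\<close>
  have "(\<Sum>v\<in>?V. card {e \<in> ?S. v \<notin> e}) = (Suc n - r) * card ?S"
  proof (rule sum_multicount[OF fV fS], intro ballI)
    fix e assume "e \<in> ?S"
    then have "e \<subseteq> ?V" "finite e" "card e = r" using S by (auto simp: nsets_def)
    moreover have "{v \<in> ?V. v \<notin> e} = ?V - e" by auto
    ultimately show "card {v \<in> ?V. v \<notin> e} = Suc n - r" by (simp add: card_Diff_subset H(2))
  qed
  moreover have "(\<Sum>v\<in>?V. card {e \<in> ?S. v \<notin> e}) \<le> (\<Sum>v\<in>?V. turan_number r n F)"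
    by (rule sum_mono) (rule del)
  ultimately show ?thesis by (simp add: H)
qed

text \<open>\<open>turan_density\<close> is defined through \<open>lim\<close>, which is informative
  only if the sequence converges. It does: from \<open>r\<close> on the ratios are nonincreasing and
  nonnegative.\<close>

lemma turan_density_LIMSEQ:
  assumes "edges F \<noteq> {}"
  shows "(\<lambda>n. real (turan_number r n F) / real (n choose r)) \<longlonglongrightarrow> turan_density r F"
proof -
  let ?f = "\<lambda>n. real (turan_number r n F) / real (n choose r)"
  \<comment> \<open>Below \<open>r\<close> the denominator is zero and the ratio is \<open>0\<close>
    by convention, so monotonicity is claimed only after a shift by \<open>r\<close>.\<close>
  have "decseq (\<lambda>n. ?f (n + r))"
  proof (rule decseq_SucI)
    fix i
    define n where "n = i + r"
    have rn: "r \<le> n" by (simp add: n_def)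
    have pos: "0 < real (n choose r)" "0 < real (Suc n choose r)" "0 < real (Suc n - r)"
      using rn by simp_all
    have eq: "real (Suc n - r) * real (Suc n choose r) = real (Suc n) * real (n choose r)"
      using binomial_absorb_comp[of "Suc n" r] by (metis diff_Suc_1 of_nat_mult)
    have le: "real (Suc n - r) * real (turan_number r (Suc n) F) \<le> real (Suc n) * real (turan_number r n F)"
      using turan_number_Suc_le[OF assms rn] by (metis of_nat_le_iff of_nat_mult)
    have "?f (Suc n) = (real (Suc n - r) * real (turan_number r (Suc n) F)) /
        (real (Suc n - r) * real (Suc n choose r))" using pos by simp
    also have "\<dots> \<le> (real (Suc n) * real (turan_number r n F)) / (real (Suc n) * real (n choose r))"
      unfolding eq using le by (rule divide_right_mono) simp
    also have "\<dots> = ?f n" by simp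
    finally show "?f (Suc i + r) \<le> ?f (i + r)" by (simp add: n_def)
  qed
  then obtain L where "(\<lambda>n. ?f (n + r)) \<longlonglongrightarrow> L"
    using decseq_convergent[of "\<lambda>n. ?f (n + r)" 0] by auto
  then have "?f \<longlonglongrightarrow> L" by (rule LIMSEQ_offset)
  moreover from this have "turan_density r F = L" unfolding turan_density_def by (rule limI)
  ultimately show ?thesis by simp
qed

text \<open>For \<open>n \<ge> 1\<close> the ratio is the product of the factors
  \<open>1 - i / n\<close> for \<open>i < k\<close>, divided by \<open>fact k\<close>. The number of
  factors is fixed and each tends to \<open>1\<close>.\<close>

lemma binomial_over_power_LIMSEQ: "(\<lambda>n. real (n choose k) / real n ^ k) \<longlonglongrightarrow> 1 / fact k"
proof -
  have "(\<lambda>n. (\<Prod>i = 0..<k. 1 - real i * inverse (real n)) / fact k) \<longlonglongrightarrow> (\<Prod>i = 0..<k. 1 - real i * 0) / fact k"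
    by (intro tendsto_intros lim_inverse_n) simp
  moreover have "\<forall>\<^sub>F n in sequentially.
      (\<Prod>i = 0..<k. 1 - real i * inverse (real n)) / fact k = real (n choose k) / real n ^ k"
  proof (rule eventually_sequentiallyI[of 1])
    fix n :: nat assume "1 \<le> n"
    then have "(\<Prod>i = 0..<k. 1 - real i * inverse (real n)) = (\<Prod>i = 0..<k. (real n - real i) / real n)"
      by (intro prod.cong) (auto simp: field_simps)
    also have "\<dots> = (\<Prod>i = 0..<k. real n - real i) / real n ^ k" by (simp add: prod_dividef)
    also have "\<dots> = real (n choose k) * fact k / real n ^ k"
      by (simp add: binomial_gbinomial gbinomial_mult_fact')
    finally show "(\<Prod>i = 0..<k. 1 - real i * inverse (real n)) / fact k = real (n choose k) / real n ^ k"
      by simp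
  qed
  ultimately show ?thesis using Lim_transform_eventually by fastforce
qed

subsection \<open>Embedding \<open>F\<close>\<close>

text \<open>Bijections between corresponding blocks are glued, \<open>c x\<close> being the only
  block index of \<open>x\<close>. Points of different blocks have different images because the
  \<open>Q i\<close> are disjoint.\<close>

lemma disjoint_family_bij:
  fixes P :: "'i \<Rightarrow> 'a set" and Q :: "'i \<Rightarrow> 'b set"
  assumes "disjoint_family_on P I" "disjoint_family_on Q I"
    and fin: "\<And>i. i \<in> I \<Longrightarrow> finite (P i) \<and> finite (Q i) \<and> card (P i) = card (Q i)"
  obtains f where "inj_on f (\<Union>i\<in>I. P i)" "\<And>i. i \<in> I \<Longrightarrow> f ` P i = Q i"
proof -
  have "\<exists>h. \<forall>i\<in>I. bij_betw (h i) (P i) (Q i)"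
    using fin finite_same_card_bij by (intro bchoice) blast
  then obtain h where h: "\<And>i. i \<in> I \<Longrightarrow> bij_betw (h i) (P i) (Q i)" by blast
  define c where "c x = (THE i. i \<in> I \<and> x \<in> P i)" for x
  have c: "c x = i" if "i \<in> I" "x \<in> P i" for i x
    unfolding c_def
  proof (rule the_equality)
    fix j assume "j \<in> I \<and> x \<in> P j"
    then show "j = i" using that assms(1) unfolding disjoint_family_on_def by blast
  qed (use that in simp)
  define f where "f x = h (c x) x" for x
  have im: "f ` P i = Q i" if "i \<in> I" for i
  proof -
    have "f ` P i = h i ` P i" using c[OF that] by (intro image_cong) (auto simp: f_def)
    then show ?thesis using h[OF that] by (simp add: bij_betw_def)
  qed
  have "inj_on f (\<Union>i\<in>I. P i)"
  proof (rule inj_onI, elim UN_E)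
    fix x y i j assume *: "f x = f y" "i \<in> I" "x \<in> P i" "j \<in> I" "y \<in> P j"
    then have "f x \<in> Q i" "f x \<in> Q j" using im by (blast, metis imageI)
    then have "i = j" using * assms(2) unfolding disjoint_family_on_def by blast
    then have "h i x = h i y" using * c by (simp add: f_def)
    moreover have "inj_on (h i) (P i)" using h[OF \<open>i \<in> I\<close>] by (rule bij_betw_imp_inj_on)
    moreover have "y \<in> P i" using *(5) \<open>i = j\<close> by simp
    ultimately show "x = y" using *(3) by (meson inj_onD)
  qed
  then show thesis using im by (rule that)
qed

lemma obtain_bij_family_with_rest:
  fixes B :: "nat \<Rightarrow> 'a set" and b :: "nat \<Rightarrow> 'b set"
  assumes fin: "finite E" "finite E'" and card: "card E = card E'"
    and B: "disjoint_family_on B {1..s}" "\<And>i. i \<in> {1..s} \<Longrightarrow> B i \<subseteq> E"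
    and b: "disjoint_family_on b {1..s}" "\<And>i. i \<in> {1..s} \<Longrightarrow> b i \<subseteq> E'"
    and cards: "\<And>i. i \<in> {1..s} \<Longrightarrow> card (B i) = card (b i)"
  obtains f where "inj_on f E" "f ` E = E'" "\<And>i. i \<in> {1..s} \<Longrightarrow> f ` B i = b i"
proof -
  \<comment> \<open>The spare index \<open>0\<close> takes the points outside all blocks, so that
    the blocks become partitions of \<open>E\<close> and \<open>E'\<close>.\<close>
  define P where "P i = (if i = 0 then E - \<Union>(B ` {1..s}) else B i)" for i
  define Q where "Q i = (if i = 0 then E' - \<Union>(b ` {1..s}) else b i)" for i
  have finB: "finite (B i)" "finite (b i)" if "i \<in> {1..s}" for i
    using finite_subset[OF B(2)[OF that] fin(1)] finite_subset[OF b(2)[OF that] fin(2)] .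
  have cU: "card (\<Union>(B ` {1..s})) = card (\<Union>(b ` {1..s}))"
  proof -
    have "card (\<Union>(B ` {1..s})) = (\<Sum>i\<in>{1..s}. card (B i))"
      using B(1) finB by (intro card_UN_disjoint) (auto simp: disjoint_family_on_def)
    also have "\<dots> = (\<Sum>i\<in>{1..s}. card (b i))" using cards by (rule sum.cong[OF refl])
    also have "\<dots> = card (\<Union>(b ` {1..s}))"
      using b(1) finB by (intro card_UN_disjoint[symmetric]) (auto simp: disjoint_family_on_def)
    finally show ?thesis .
  qed
  have c0: "card (P 0) = card (Q 0)"
  proof -
    have sub: "\<Union>(B ` {1..s}) \<subseteq> E" "\<Union>(b ` {1..s}) \<subseteq> E'" using B(2) b(2) by blast+
    have "finite (\<Union>(B ` {1..s}))" "finite (\<Union>(b ` {1..s}))" using finB by blast+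
    then have "card (E - \<Union>(B ` {1..s})) = card (E' - \<Union>(b ` {1..s}))"
      using cU card sub by (simp only: card_Diff_subset)
    then show ?thesis by (simp add: P_def Q_def)
  qed
  have dP: "disjoint_family_on P {..s}" and dQ: "disjoint_family_on Q {..s}"
    using B(1) b(1) unfolding disjoint_family_on_def P_def Q_def by auto
  have pq: "finite (P i) \<and> finite (Q i) \<and> card (P i) = card (Q i)" if "i \<in> {..s}" for i
    using that c0 fin finB[of i] cards[of i] by (cases "i = 0") (auto simp: P_def Q_def)
  obtain f where f: "inj_on f (\<Union>i\<in>{..s}. P i)" "\<And>i. i \<in> {..s} \<Longrightarrow> f ` P i = Q i"
    using disjoint_family_bij[OF dP dQ pq] by blast
  have idx: "{..s} = insert 0 {1..s}" by auto
  have UP: "(\<Union>i\<in>{..s}. P i) = E" unfolding idx using B(2) by (fastforce simp: P_def)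
  have UQ: "(\<Union>i\<in>{..s}. Q i) = E'" unfolding idx using b(2) by (fastforce simp: Q_def)
  have "f ` (\<Union>i\<in>{..s}. P i) = (\<Union>i\<in>{..s}. Q i)"
    unfolding image_UN using f(2) by (intro SUP_cong) auto
  then have onto: "f ` E = E'" unfolding UP UQ .
  have inj: "inj_on f E" using f(1) unfolding UP .
  have "f ` B i = b i" if "i \<in> {1..s}" for i
    using f(2)[of i] that by (simp add: P_def Q_def)
  with inj onto show thesis by (intro that[of f])
qed

lemma is_T_edges_nonempty: "is_T r a k s F \<Longrightarrow> edges F \<noteq> {}"
  unfolding is_T_def is_uniform_extension_def by auto

text \<open>The sets \<open>U i\<close> serve as the private vertices: the partial edge belonging to
  \<open>B i\<close> has \<open>a + (r - k)\<close> points, hence needs \<open>k - a\<close>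
  more.\<close>

lemma contains_copy_is_T:
  fixes F :: "'v hypergraph" and H :: "'w hypergraph"
  assumes T: "is_T r a k s F" and ak: "a \<le> k" "k \<le> r" and H: "r_graph r H"
    and E: "E \<in> edges H" and A: "finite A" "card A = a" "A \<inter> E = {}" "A \<subseteq> verts H"
    and b: "disjoint_family_on b {1..s}" "\<And>i. i \<in> {1..s} \<Longrightarrow> b i \<subseteq> E \<and> card (b i) = k"
    and U: "disjoint_family_on U {1..s}"
      "\<And>i. i \<in> {1..s} \<Longrightarrow> U i \<subseteq> verts H \<and> card (U i) = k - a \<and> U i \<inter> E = {} \<and> A \<inter> U i = {}"
    and edge: "\<And>i. i \<in> {1..s} \<Longrightarrow> A \<union> U i \<union> (E - b i) \<in> edges H"
  shows "contains_copy H F"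
proof -
  have fV: "finite (verts H)" and EV: "E \<subseteq> verts H" "finite E" "card E = r"
    using H E by (auto simp: r_graph_def nsets_def)
  obtain A0 E0 B0 where A0: "finite A0" "card A0 = a" and E0: "finite E0" "card E0 = r"
    and AE: "A0 \<inter> E0 = {}"
    and B0: "\<And>i. i \<in> {1..s} \<Longrightarrow> B0 i \<subseteq> E0 \<and> card (B0 i) = k" "disjoint_family_on B0 {1..s}"
    and ext: "is_uniform_extension r (A0 \<union> E0) (E0 # map (\<lambda>i. A0 \<union> (E0 - B0 i)) [1..<Suc s]) F"
    using T unfolding is_T_def by blast
  define es where "es = E0 # map (\<lambda>i. A0 \<union> (E0 - B0 i)) [1..<Suc s]"
  have len: "length es = Suc s" by (simp add: es_def)
  have nth0: "es ! 0 = E0" by (simp add: es_def)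
  \<comment> \<open>The head of the list is \<open>E0\<close>, so position \<open>i\<close> holds
    the partial edge of \<open>B0 i\<close> even though list positions start at
    \<open>0\<close>.\<close>
  have nth: "es ! i = A0 \<union> (E0 - B0 i)" if i: "i \<in> {1..s}" for i
  proof -
    obtain j where "i = Suc j" "j < s" using i by (cases i) auto
    then show ?thesis by (simp add: es_def del: upt_Suc)
  qed
  obtain U0 where
    U0: "\<And>j. j < Suc s \<Longrightarrow> finite (U0 j) \<and> card (U0 j) = r - card (es ! j) \<and> U0 j \<inter> (A0 \<union> E0) = {}"
    and dU0: "disjoint_family_on U0 {..<Suc s}"
    and vF: "verts F = A0 \<union> E0 \<union> (\<Union>j<Suc s. U0 j)"
    and eF: "edges F = (\<lambda>j. es ! j \<union> U0 j) ` {..<Suc s}"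
  proof -
    have "\<exists>U0. (\<forall>j<Suc s. finite (U0 j) \<and> card (U0 j) = r - card (es ! j) \<and> U0 j \<inter> (A0 \<union> E0) = {}) \<and>
        disjoint_family_on U0 {..<Suc s} \<and> verts F = A0 \<union> E0 \<union> (\<Union>j<Suc s. U0 j) \<and>
        edges F = (\<lambda>j. es ! j \<union> U0 j) ` {..<Suc s}"
      using ext[folded es_def] unfolding is_uniform_extension_def len by (elim conjE)
    then show thesis by (elim exE conjE) (rule that, simp_all only: simp_thms)
  qed
  \<comment> \<open>\<open>E0\<close> already has \<open>r\<close> points and receives no private
    vertices.\<close>
  have U00: "U0 0 = {}" using U0[of 0] E0 by (auto simp: nth0)
  have idx: "{..<Suc s} = insert 0 {1..s}" by auto
  have cU0: "card (U0 i) = k - a" if i: "i \<in> {1..s}" for i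
  proof -
    have "card (es ! i) = a + (r - k)"
    proof -
      have "B0 i \<subseteq> E0" "finite (B0 i)" "card (B0 i) = k"
        using B0(1)[OF i] E0(1) by (auto intro: finite_subset)
      then have "card (E0 - B0 i) = r - k" using E0(2) by (simp add: card_Diff_subset)
      moreover have "card (A0 \<union> (E0 - B0 i)) = card A0 + card (E0 - B0 i)"
        using A0 E0 AE by (intro card_Un_disjoint) auto
      ultimately show ?thesis using A0(2) nth[OF i] by simp
    qed
    then show ?thesis using U0[of i] i ak by simp
  qed
  have fU: "finite (U i)" if "i \<in> {1..s}" for i using U(2)[OF that] fV finite_subset by blast
  have dU0': "disjoint_family_on U0 {1..s}"
    using dU0 by (rule disjoint_family_on_mono[rotated]) auto
  obtain f1 where f1: "inj_on f1 E0" "f1 ` E0 = E" "\<And>i. i \<in> {1..s} \<Longrightarrow> f1 ` B0 i = b i"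
    using obtain_bij_family_with_rest[of E0 E B0 s b] E0 EV B0 b by auto
  obtain f2 where f2: "inj_on f2 (\<Union>i\<in>{1..s}. U0 i)" "\<And>i. i \<in> {1..s} \<Longrightarrow> f2 ` U0 i = U i"
  proof -
    have "finite (U0 i) \<and> finite (U i) \<and> card (U0 i) = card (U i)" if "i \<in> {1..s}" for i
      using that U0[of i] cU0 U(2) fU by simp
    then show thesis using disjoint_family_bij[OF dU0' U(1)] that by blast
  qed
  obtain f3 where f3: "bij_betw f3 A0 A"
    using A A0 finite_same_card_bij by metis
  \<comment> \<open>Three bijections on disjoint pieces: \<open>E0\<close> with its blocks, the
    kernel \<open>A0\<close>, and the private vertices. Their images \<open>E\<close>,
    \<open>A\<close> and the union of the \<open>U i\<close> are disjoint, so \<open>f\<close> is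
    injective.\<close>
  define f where "f x = (if x \<in> E0 then f1 x else if x \<in> A0 then f3 x else f2 x)" for x
  have fE: "f ` X = f1 ` X" if "X \<subseteq> E0" for X
    using that by (intro image_cong) (auto simp: f_def)
  have fA: "f ` A0 = A"
  proof -
    have "f ` A0 = f3 ` A0" using AE by (intro image_cong) (auto simp: f_def)
    then show ?thesis using f3 by (simp add: bij_betw_def)
  qed
  have fU0: "f ` U0 i = U i" if i: "i \<in> {1..s}" for i
  proof -
    have "U0 i \<inter> (A0 \<union> E0) = {}" using U0[of i] i by simp
    then have "f ` U0 i = f2 ` U0 i" by (intro image_cong) (auto simp: f_def)
    then show ?thesis using f2(2)[OF i] by simp
  qed
  have vF': "verts F = E0 \<union> (A0 \<union> (\<Union>i\<in>{1..s}. U0 i))"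
    unfolding vF idx using U00 by auto
  have dis0: "(\<Union>i\<in>{1..s}. U0 i) \<inter> (A0 \<union> E0) = {}"
  proof -
    have "U0 i \<inter> (A0 \<union> E0) = {}" if "i \<in> {1..s}" for i using U0[of i] that by simp
    then show ?thesis by blast
  qed
  have fUU: "f ` (\<Union>i\<in>{1..s}. U0 i) = (\<Union>i\<in>{1..s}. U i)"
    unfolding image_UN using fU0 by (intro SUP_cong) auto
  have inj1: "inj_on f E0" using f1(1) by (rule inj_on_cong[THEN iffD1, rotated]) (simp add: f_def)
  have inj2: "inj_on f (\<Union>i\<in>{1..s}. U0 i)"
    using f2(1) dis0 by (subst inj_on_cong[of _ f f2]) (auto simp: f_def)
  have inj3: "inj_on f A0"
    using f3 AE by (subst inj_on_cong[of _ f f3]) (auto simp: f_def bij_betw_def)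
  have "inj_on f (A0 \<union> (\<Union>i\<in>{1..s}. U0 i))"
  proof (subst inj_on_Un, intro conjI inj3 inj2)
    have "A \<inter> (\<Union>i\<in>{1..s}. U i) = {}" using U(2) by blast
    then show "f ` (A0 - (\<Union>i\<in>{1..s}. U0 i)) \<inter> f ` ((\<Union>i\<in>{1..s}. U0 i) - A0) = {}"
      using fA fUU by blast
  qed
  then have "inj_on f (verts F)"
  proof (unfold vF', subst inj_on_Un, intro conjI inj1)
    let ?W = "A0 \<union> (\<Union>i\<in>{1..s}. U0 i)" and ?W' = "A \<union> (\<Union>i\<in>{1..s}. U i)"
    have "f ` ?W = ?W'" by (simp only: image_Un fA fUU)
    then have "f ` (?W - E0) \<subseteq> ?W'" by blast
    moreover have "f ` E0 = E" using fE[of E0] f1(2) by simp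
    then have "f ` (E0 - ?W) \<subseteq> E" by blast
    moreover have "E \<inter> ?W' = {}" using U(2) A by blast
    ultimately show "f ` (E0 - ?W) \<inter> f ` (?W - E0) = {}" by blast
  qed
  moreover have "f ` verts F \<subseteq> verts H"
  proof -
    have "f ` E0 = E" using fE[of E0] f1(2) by simp
    moreover have "(\<Union>i\<in>{1..s}. U i) \<subseteq> verts H" using U(2) by blast
    ultimately show ?thesis unfolding vF' image_Un fA fUU using EV(1) A(4) by simp
  qed
  moreover have "f ` e \<in> edges H" if e: "e \<in> edges F" for e
  proof -
    from e consider "e = E0 \<union> U0 0" | i where "i \<in> {1..s}" "e = es ! i \<union> U0 i"
      unfolding eF idx using nth0 by auto
    then show ?thesis
    proof cases
      case 1
      then show ?thesis using fE[of E0] f1(2) U00 E by simp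
    next
      case (2 i)
      have "f1 ` (E0 - B0 i) = E - b i"
        using inj_on_image_set_diff[OF f1(1), of E0 "B0 i"] B0(1)[OF 2(1)] f1(2) f1(3)[OF 2(1)] by simp
      then have "f ` e = A \<union> U i \<union> (E - b i)"
        using fE[of "E0 - B0 i"] fU0[OF 2(1)] by (auto simp: 2(2) nth[OF 2(1)] image_Un fA)
      then show ?thesis using edge[OF 2(1)] by simp
    qed
  qed
  ultimately show ?thesis unfolding contains_copy_def by blast
qed

subsection \<open>Counting\<close>

text \<open>Each such \<open>A\<close> is assigned to a matching of \<open>s\<close> sets
  \<open>B\<close> that it admits. The factor \<open>2 ^ (r choose k)\<close> counts all subfamilies
  of \<open>nsets E k\<close>, hence bounds the number of classes; the other factor is the sunflower
  threshold for one class.\<close>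

lemma card_sets_exceeding_max_family_le:
  fixes F :: "'v hypergraph" and H :: "'w hypergraph"
  assumes T: "is_T r a k s F" and s: "1 \<le> s" and ak: "a \<le> k" "k \<le> r"
    and H: "r_graph r H" "free_of F H" and E: "E \<in> edges H"
  shows "card {A \<in> nsets (verts H) k. A \<inter> E = {} \<and>
           max_family r k (s - 1) < card {B \<in> nsets E k. A \<union> (E - B) \<in> edges H}}
         \<le> 2 ^ (r choose k) * (s * k * card (verts H) ^ (k - 1))"
proof -
  let ?V = "verts H" and ?c = "s * k * card (verts H) ^ (k - 1)"
  have fV: "finite ?V" and HV: "edges H \<subseteq> nsets ?V r" using H by (auto simp: r_graph_def)
  have EV: "E \<subseteq> ?V" "finite E" "card E = r" using HV E by (auto simp: nsets_def)
  define Ms where "Ms = {\<M>. \<M> \<subseteq> nsets E k \<and> disjoint \<M> \<and> card \<M> = s}"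
  define G where "G \<M> = {A \<in> nsets ?V k. A \<inter> E = {} \<and> (\<forall>B\<in>\<M>. A \<union> (E - B) \<in> edges H)}" for \<M>
  have fP: "finite (Pow (nsets E k))" by (simp add: EV finite_imp_finite_nsets)
  have MP: "Ms \<subseteq> Pow (nsets E k)" by (auto simp: Ms_def)
  have fM: "finite Ms" using MP fP by (rule finite_subset)
  have "card Ms \<le> card (Pow (nsets E k))" using fP MP by (rule card_mono)
  then have cM: "card Ms \<le> 2 ^ (r choose k)"
    using EV by (simp add: card_Pow finite_imp_finite_nsets card_nsets)
  have fG: "finite (G \<M>)" for \<M> by (simp add: G_def fV finite_imp_finite_nsets)
  have cG: "card (G \<M>) \<le> ?c" if M: "\<M> \<in> Ms" for \<M>
  proof (rule ccontr)
    assume "\<not> ?thesis"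
    then have large: "?c < card (G \<M>)" by simp
    have "G \<M> \<subseteq> nsets ?V k" by (auto simp: G_def)
    then obtain A U where A: "finite A" "card A = a" "A \<subseteq> ?V" and U: "disjoint_family_on U {1..s}"
      "\<And>i. i \<in> {1..s} \<Longrightarrow> A \<union> U i \<in> G \<M> \<and> A \<inter> U i = {}"
      using exists_sunflower_with_kernel[OF fV _ ak(1) large] by blast
    have "finite \<M>" using M s by (intro card_ge_0_finite) (auto simp: Ms_def)
    then obtain b where b: "bij_betw b {1..s} \<M>" "disjoint_family_on b {1..s}"
      using disjoint_enumeration[of \<M> s] M by (auto simp: Ms_def)
    have bM: "b i \<in> \<M>" if "i \<in> {1..s}" for i using b(1) that by (auto simp: bij_betw_def)
    have AU: "A \<union> U i \<subseteq> ?V" "finite (A \<union> U i)" "card (A \<union> U i) = k" "(A \<union> U i) \<inter> E = {}"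
      "A \<union> U i \<union> (E - b i) \<in> edges H" if i: "i \<in> {1..s}" for i
      using U(2)[OF i] bM[OF i] unfolding G_def nsets_def by auto
    \<comment> \<open>Every member of the class is compatible with every set of the matching, so
      petal \<open>i\<close> may be paired with \<open>b i\<close>.\<close>
    have "contains_copy H F"
    proof (rule contains_copy_is_T[OF T ak H(1) E A(1,2) _ A(3) b(2) _ U(1)])
      \<comment> \<open>As \<open>s \<ge> 1\<close> there is a petal \<open>U 1\<close>, and the
        kernel lies in \<open>A \<union> U 1\<close>, which avoids \<open>E\<close>.\<close>
      show "A \<inter> E = {}" using AU(4)[of 1] s by auto
      show "b i \<subseteq> E \<and> card (b i) = k" if "i \<in> {1..s}" for i
        using bM[OF that] M by (auto simp: Ms_def nsets_def)
      show "A \<union> U i \<union> (E - b i) \<in> edges H" if "i \<in> {1..s}" for i using AU(5)[OF that] .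
      show "U i \<subseteq> ?V \<and> card (U i) = k - a \<and> U i \<inter> E = {} \<and> A \<inter> U i = {}" if i: "i \<in> {1..s}" for i
      proof -
        have "card (A \<union> U i) = card A + card (U i)"
          using AU(2)[OF i] U(2)[OF i] by (intro card_Un_disjoint) auto
        then have "card (U i) = k - a" using AU(3)[OF i] A(2) by simp
        then show ?thesis using AU(1,4)[OF i] U(2)[OF i] by auto
      qed
    qed
    then show False using H(2) by (simp add: free_of_def)
  qed
  have sub: "{A \<in> nsets ?V k. A \<inter> E = {} \<and>
      max_family r k (s - 1) < card {B \<in> nsets E k. A \<union> (E - B) \<in> edges H}} \<subseteq> (\<Union>\<M>\<in>Ms. G \<M>)"
  proof
    fix A assume A: "A \<in> {A \<in> nsets ?V k. A \<inter> E = {} \<and>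
      max_family r k (s - 1) < card {B \<in> nsets E k. A \<union> (E - B) \<in> edges H}}"
    let ?B = "{B \<in> nsets E k. A \<union> (E - B) \<in> edges H}"
    obtain \<M> where M: "\<M> \<subseteq> ?B" "disjoint \<M>" "card \<M> = Suc (s - 1)"
      by (rule max_family_less_imp_matching[of E r ?B k "s - 1"]) (use EV A in auto)
    then have "\<M> \<in> Ms" using s by (auto simp: Ms_def)
    moreover have "A \<in> G \<M>" using M(1) A by (auto simp: G_def)
    ultimately show "A \<in> (\<Union>\<M>\<in>Ms. G \<M>)" by blast
  qed
  have "card {A \<in> nsets ?V k. A \<inter> E = {} \<and>
      max_family r k (s - 1) < card {B \<in> nsets E k. A \<union> (E - B) \<in> edges H}} \<le> card (\<Union>\<M>\<in>Ms. G \<M>)"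
    using fM fG by (intro card_mono sub) auto
  also have "\<dots> \<le> (\<Sum>\<M>\<in>Ms. card (G \<M>))" using fM by (rule card_UN_le)
  also have "\<dots> \<le> (\<Sum>\<M>\<in>Ms. ?c)" using cG by (rule sum_mono)
  also have "\<dots> = card Ms * ?c" by simp
  also have "\<dots> \<le> 2 ^ (r choose k) * ?c" using cM by (rule mult_le_mono1)
  finally show ?thesis .
qed

section \<open>Codegree sums and the resulting edge bound\<close>

definition codegree :: "'v hypergraph \<Rightarrow> 'v set \<Rightarrow> nat" where
  "codegree H S = card {e \<in> edges H. S \<subseteq> e}"

text \<open>Edges through \<open>S\<close> are replaced by what they have outside \<open>S\<close>,
  so that a sum over \<open>S\<close> can be exchanged with a sum over \<open>k\<close>-sets
  \<open>A\<close>.\<close>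

lemma codegree_eq_card_link:
  assumes H: "r_graph r H" and S: "S \<subseteq> verts H" "card S = r - k" and k: "k \<le> r"
  shows "codegree H S = card {A \<in> nsets (verts H) k. A \<inter> S = {} \<and> A \<union> S \<in> edges H}"
proof -
  have fV: "finite (verts H)" and HV: "edges H \<subseteq> nsets (verts H) r"
    using H by (auto simp: r_graph_def)
  have fS: "finite S" using S fV by (meson finite_subset)
  have "bij_betw (\<lambda>e. e - S) {e \<in> edges H. S \<subseteq> e}
      {A \<in> nsets (verts H) k. A \<inter> S = {} \<and> A \<union> S \<in> edges H}"
  proof (rule bij_betw_byWitness[where f' = "\<lambda>A. A \<union> S"])
    show "(\<lambda>e. e - S) ` {e \<in> edges H. S \<subseteq> e}
        \<subseteq> {A \<in> nsets (verts H) k. A \<inter> S = {} \<and> A \<union> S \<in> edges H}"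
    proof (intro image_subsetI CollectI conjI)
      fix e assume e: "e \<in> {e \<in> edges H. S \<subseteq> e}"
      then have "e \<subseteq> verts H" "finite e" "card e = r" using HV by (auto simp: nsets_def)
      then show "e - S \<in> nsets (verts H) k"
        using e S k fS by (auto simp: nsets_def card_Diff_subset)
      show "(e - S) \<inter> S = {}" by auto
      have "e - S \<union> S = e" using e by auto
      then show "e - S \<union> S \<in> edges H" using e by simp
    qed
  qed auto
  then show ?thesis unfolding codegree_def by (rule bij_betw_same_card)
qed

text \<open>With \<open>S = E - B\<close> the sum counts pairs \<open>(A, B)\<close>. Most
  \<open>A\<close> contribute at most \<open>max_family r k (s - 1)\<close>; the bad ones and those
  meeting \<open>E\<close> contribute at most \<open>r choose k\<close> each, and their numbers
  yield the terms \<open>2 ^ (r choose k) * (s * k)\<close> and \<open>r\<close> of the error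
  constant.\<close>

lemma sum_codegree_le:
  fixes F :: "'v hypergraph" and H :: "'w hypergraph"
  assumes T: "is_T r a k s F" and s: "1 \<le> s" and ak: "a \<le> k" "k \<le> r"
    and H: "r_graph r H" "free_of F H" and E: "E \<in> edges H"
  shows "(\<Sum>S\<in>nsets E (r - k). codegree H S) \<le>
      max_family r k (s - 1) * (card (verts H) choose k) +
      (r choose k) * (2 ^ (r choose k) * (s * k) + r) * card (verts H) ^ (k - 1)"
proof -
  let ?V = "verts H" and ?M = "max_family r k (s - 1)"
  have fV: "finite ?V" and HV: "edges H \<subseteq> nsets ?V r" using H by (auto simp: r_graph_def)
  have EV: "E \<subseteq> ?V" "finite E" "card E = r" using HV E by (auto simp: nsets_def)
  \<comment> \<open>Only disjointness from \<open>E - B\<close> is available, since an edge through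
    \<open>E - B\<close> may also use points of \<open>B\<close>. The \<open>A\<close> arising from
    this go into \<open>meet\<close>.\<close>
  let ?R = "\<lambda>A B. A \<inter> (E - B) = {} \<and> A \<union> (E - B) \<in> edges H"
  let ?d = "\<lambda>A. card {B \<in> nsets E k. ?R A B}"
  define bad where "bad = {A \<in> nsets ?V k. A \<inter> E = {} \<and>
      ?M < card {B \<in> nsets E k. A \<union> (E - B) \<in> edges H}}"
  define meet where "meet = {A \<in> nsets ?V k. A \<inter> E \<noteq> {}}"
  have fin: "finite (nsets E k)" "finite (nsets ?V k)" using EV fV by (simp_all add: finite_imp_finite_nsets)
  have "(\<Sum>S\<in>nsets E (r - k). codegree H S) = (\<Sum>B\<in>nsets E k. codegree H (E - B))"
  proof (rule sum.reindex_bij_witness[of _ "\<lambda>B. E - B" "\<lambda>S. E - S"])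
    fix S assume "S \<in> nsets E (r - k)"
    then have S: "S \<subseteq> E" "finite S" "card S = r - k" by (auto simp: nsets_def)
    then show eq: "E - (E - S) = S" by auto
    then show "codegree H (E - (E - S)) = codegree H S" by simp
    show "E - S \<in> nsets E k" using S EV ak by (auto simp: nsets_def card_Diff_subset)
  next
    fix B assume "B \<in> nsets E k"
    then have B: "B \<subseteq> E" "finite B" "card B = k" by (auto simp: nsets_def)
    then show "E - (E - B) = B" by auto
    show "E - B \<in> nsets E (r - k)" using B EV by (auto simp: nsets_def card_Diff_subset)
  qed
  also have "\<dots> = (\<Sum>B\<in>nsets E k. card {A \<in> nsets ?V k. ?R A B})"
  proof (rule sum.cong[OF refl])
    fix B assume "B \<in> nsets E k"
    then have B: "B \<subseteq> E" "finite B" "card B = k" by (auto simp: nsets_def)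
    show "codegree H (E - B) = card {A \<in> nsets ?V k. ?R A B}"
      by (rule codegree_eq_card_link[OF H(1) _ _ ak(2)]) (use B EV in \<open>auto simp: card_Diff_subset\<close>)
  qed
  also have "\<dots> = (\<Sum>A\<in>nsets ?V k. ?d A)"
    by (rule sum_multicount_gen) (use fin in auto)
  also have "\<dots> \<le> (\<Sum>A\<in>nsets ?V k. ?M + (if A \<in> bad \<union> meet then r choose k else 0))"
  proof (rule sum_mono)
    fix A assume A: "A \<in> nsets ?V k"
    show "?d A \<le> ?M + (if A \<in> bad \<union> meet then r choose k else 0)"
    proof (cases "A \<in> bad \<union> meet")
      case True
      have "?d A \<le> card (nsets E k)" using fin by (intro card_mono) auto
      then show ?thesis using True EV by (simp add: card_nsets)
    next
      case False
      then have "A \<inter> E = {}" using A by (auto simp: meet_def)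
      then have "{B \<in> nsets E k. ?R A B} = {B \<in> nsets E k. A \<union> (E - B) \<in> edges H}" by auto
      then show ?thesis using False A \<open>A \<inter> E = {}\<close> by (auto simp: bad_def)
    qed
  qed
  also have "\<dots> = ?M * (card ?V choose k) + (r choose k) * card (bad \<union> meet)"
  proof -
    have "nsets ?V k \<inter> (bad \<union> meet) = bad \<union> meet" by (auto simp: bad_def meet_def)
    then show ?thesis
      using fin by (simp only: sum.distrib flip: sum.inter_restrict) (simp add: card_nsets fV)
  qed
  also have "card (bad \<union> meet) \<le> card bad + card meet" by (rule card_Un_le)
  also have "card bad \<le> 2 ^ (r choose k) * (s * k * card ?V ^ (k - 1))"
    unfolding bad_def by (rule card_sets_exceeding_max_family_le[OF T s ak H E])
  also have "card meet \<le> r * card ?V ^ (k - 1)"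
    unfolding meet_def using card_nsets_meeting[OF fV EV(2)] EV(3) by simp
  finally show ?thesis by (simp add: algebra_simps)
qed

text \<open>Cauchy--Schwarz against a constant vector: the square is expanded into a double sum and
  \<open>x * y\<close> is bounded by half of the sum of the squares.\<close>

lemma sum_squared_le_card_mult_sum_squares:
  fixes d :: "'a \<Rightarrow> nat"
  shows "(\<Sum>i\<in>I. d i)\<^sup>2 \<le> card I * (\<Sum>i\<in>I. (d i)\<^sup>2)"
proof -
  let ?d = "\<lambda>i. real (d i)"
  have "(\<Sum>i\<in>I. ?d i)\<^sup>2 = (\<Sum>i\<in>I. \<Sum>j\<in>I. ?d i * ?d j)"
    by (simp add: power2_eq_square sum_product)
  also have "\<dots> \<le> (\<Sum>i\<in>I. \<Sum>j\<in>I. ((?d i)\<^sup>2 + (?d j)\<^sup>2) / 2)"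
    using sum_squares_bound by (intro sum_mono) (simp add: field_simps)
  also have "\<dots> = real (card I) * (\<Sum>i\<in>I. (?d i)\<^sup>2)"
    by (simp add: sum.distrib flip: sum_divide_distrib sum_distrib_left)
  finally have "real ((\<Sum>i\<in>I. d i)\<^sup>2) \<le> real (card I * (\<Sum>i\<in>I. (d i)\<^sup>2))" by simp
  then show ?thesis by (simp only: of_nat_le_iff)
qed

text \<open>Double counting of the pairs \<open>S \<subseteq> E\<close> with \<open>E\<close> an
  edge, first unweighted and then with weight \<open>codegree H S\<close>; each \<open>S\<close>
  occurs in \<open>codegree H S\<close> pairs.\<close>

lemma sum_codegree:
  assumes "r_graph r H"
  shows "(\<Sum>S\<in>nsets (verts H) j. codegree H S) = card (edges H) * (r choose j)"
    and "(\<Sum>S\<in>nsets (verts H) j. (codegree H S)\<^sup>2) = (\<Sum>E\<in>edges H. \<Sum>S\<in>nsets E j. codegree H S)"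
proof -
  let ?N = "nsets (verts H) j"
  have fV: "finite (verts H)" and HV: "edges H \<subseteq> nsets (verts H) r"
    using assms by (auto simp: r_graph_def)
  have fN: "finite ?N" by (simp add: fV finite_imp_finite_nsets)
  have fE: "finite (edges H)" by (rule finite_subset[OF HV]) (simp add: fV finite_imp_finite_nsets)
  have sub: "nsets E j = {S \<in> ?N. S \<subseteq> E}" if "E \<in> edges H" for E
    using that HV by (auto simp: nsets_def)
  have c: "\<forall>E\<in>edges H. card {S \<in> ?N. S \<subseteq> E} = r choose j"
  proof
    fix E assume E: "E \<in> edges H"
    then have "finite E" "card E = r" using HV by (auto simp: nsets_def)
    then show "card {S \<in> ?N. S \<subseteq> E} = r choose j" using card_nsets[of E j] sub[OF E] by simp
  qed
  show "(\<Sum>S\<in>?N. codegree H S) = card (edges H) * (r choose j)"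
    unfolding codegree_def using sum_multicount[OF fN fE c] by simp
  have "(\<Sum>E\<in>edges H. \<Sum>S\<in>nsets E j. codegree H S) = (\<Sum>E\<in>edges H. \<Sum>S | S \<in> ?N \<and> S \<subseteq> E. codegree H S)"
    using sub by (intro sum.cong) auto
  also have "\<dots> = (\<Sum>S\<in>?N. \<Sum>E | E \<in> edges H \<and> S \<subseteq> E. codegree H S)"
    by (rule sum.swap_restrict) (use fN fE in auto)
  also have "\<dots> = (\<Sum>S\<in>?N. (codegree H S)\<^sup>2)"
    by (simp add: power2_eq_square) (simp add: codegree_def)
  finally show "(\<Sum>S\<in>?N. (codegree H S)\<^sup>2) = (\<Sum>E\<in>edges H. \<Sum>S\<in>nsets E j. codegree H S)" ..
qed

lemma card_edges_free_of_T_le: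
  fixes F :: "'v hypergraph" and H :: "'w hypergraph"
  assumes T: "is_T r a k s F" and s: "1 \<le> s" and ak: "a \<le> k" "k \<le> r"
    and H: "r_graph r H" "free_of F H"
  shows "card (edges H) * (r choose k)\<^sup>2 \<le> (card (verts H) choose (r - k)) *
      (max_family r k (s - 1) * (card (verts H) choose k) +
       (r choose k) * (2 ^ (r choose k) * (s * k) + r) * card (verts H) ^ (k - 1))"
proof (cases "card (edges H) = 0")
  case False
  let ?h = "card (edges H)" and ?N = "nsets (verts H) (r - k)"
  let ?X = "max_family r k (s - 1) * (card (verts H) choose k) +
       (r choose k) * (2 ^ (r choose k) * (s * k) + r) * card (verts H) ^ (k - 1)"
  have fV: "finite (verts H)" using H by (auto simp: r_graph_def)
  have "(?h * (r choose k))\<^sup>2 = (\<Sum>S\<in>?N. codegree H S)\<^sup>2"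
    using sum_codegree(1)[OF H(1), of "r - k"] binomial_symmetric[OF ak(2)] by simp
  also have "\<dots> \<le> card ?N * (\<Sum>S\<in>?N. (codegree H S)\<^sup>2)" by (rule sum_squared_le_card_mult_sum_squares)
  also have "(\<Sum>S\<in>?N. (codegree H S)\<^sup>2) = (\<Sum>E\<in>edges H. \<Sum>S\<in>nsets E (r - k). codegree H S)"
    by (rule sum_codegree(2)[OF H(1)])
  also have "\<dots> \<le> (\<Sum>E\<in>edges H. ?X)"
    by (rule sum_mono) (rule sum_codegree_le[OF T s ak H])
  \<comment> \<open>One factor \<open>?h\<close> on the right comes from summing over the edges and
    cancels one on the left; hence the separate case of an edgeless \<open>H\<close>.\<close>
  finally have "?h * (?h * (r choose k)\<^sup>2) \<le> ?h * ((card (verts H) choose (r - k)) * ?X)"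
    by (simp add: card_nsets fV power2_eq_square mult_ac)
  then show ?thesis using False by (simp only: mult_le_cancel1)
qed simp

section \<open>Passage from the edge bound to densities\<close>

theorem theorem1p3:
  fixes r k a s :: nat and F :: "'v hypergraph"
  assumes "s \<ge> 2" and "1 \<le> a" and "a \<le> k" and "k < r" and "s * k \<le> r"
    and "is_T r a k s F"
  shows "turan_density r F \<le> real (max_family r k (s - 1)) / real (r choose k)"
proof -
  let ?M = "max_family r k (s - 1)" and ?b = "real (r choose k)"
  define C where "C = (r choose k) * (2 ^ (r choose k) * (s * k) + r)"
  \<comment> \<open>Binomials are normalised by powers of \<open>n\<close>. As
    \<open>(r - k) + k = r\<close>, these powers cancel in the final ratio, except for a factor
    \<open>1 / n\<close> at the error term.\<close>
  define u where "u j n = real (n choose j) / real n ^ j" for j n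
  have k: "k \<le> r" "0 < k" using assms by auto
  have bpos: "0 < ?b" using k by simp
  have u: "u j \<longlonglongrightarrow> 1 / fact j" for j
    unfolding u_def by (rule binomial_over_power_LIMSEQ)
  have lim: "(\<lambda>n. u (r - k) n * (?M * u k n + C * inverse (real n)) / (?b\<^sup>2 * u r n))
      \<longlonglongrightarrow> 1 / fact (r - k) * (?M * (1 / fact k) + C * 0) / (?b\<^sup>2 * (1 / fact r))"
    using bpos by (intro tendsto_intros u lim_inverse_n) (auto intro: tendsto_mult_right_zero lim_inverse_n)
  \<comment> \<open>This identity collapses the factorials in the limit and leaves
    \<open>?M * ?b / ?b\<^sup>2\<close>.\<close>
  have "fact r = fact k * fact (r - k) * ?b"
    using binomial_fact_lemma[OF k(1)] by (metis of_nat_fact of_nat_mult)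
  then have "1 / fact (r - k) * (?M * (1 / fact k) + C * 0) / (?b\<^sup>2 * (1 / fact r)) = ?M * ?b / ?b\<^sup>2"
    by simp
  also have "\<dots> = ?M / ?b" using bpos by (simp add: power2_eq_square)
  finally have limit_eq: "1 / fact (r - k) * (?M * (1 / fact k) + C * 0) / (?b\<^sup>2 * (1 / fact r)) = ?M / ?b" .
  have F: "edges F \<noteq> {}" using assms is_T_edges_nonempty by blast
  have "turan_density r F \<le> 1 / fact (r - k) * (?M * (1 / fact k) + C * 0) / (?b\<^sup>2 * (1 / fact r))"
  proof (rule LIMSEQ_le[OF turan_density_LIMSEQ[OF F] lim], intro exI allI impI)
    fix n assume n: "r \<le> n"
    then have npos: "0 < real n" using assms by simp
    obtain H :: "nat hypergraph" where H: "r_graph r H" "card (verts H) = n" "free_of F H"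
      "card (edges H) = turan_number r n F"
      using obtain_turan_extremal[OF F] by blast
    have "turan_number r n F * (r choose k)\<^sup>2 \<le>
        (n choose (r - k)) * (?M * (n choose k) + C * n ^ (k - 1))"
      using card_edges_free_of_T_le[OF assms(6) _ assms(3) k(1) H(1,3)] assms(1) H by (simp add: C_def)
    then have "real (turan_number r n F * (r choose k)\<^sup>2) \<le>
        real ((n choose (r - k)) * (?M * (n choose k) + C * n ^ (k - 1)))"
      by (simp only: of_nat_le_iff)
    then have le: "real (turan_number r n F) * ?b\<^sup>2 \<le>
        real (n choose (r - k)) * (?M * real (n choose k) + C * real n ^ (k - 1))"
      by simp
    have ch: "real (n choose j) = u j n * real n ^ j" for j
      using npos by (simp add: u_def)
    \<comment> \<open>Since \<open>0 < k\<close>, the truncated exponent is a true predecessor; this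
      yields the factor \<open>1 / n\<close> that makes the error vanish.\<close>
    have "real n ^ (k - 1) = inverse (real n) * real n ^ k"
      using npos k by (simp add: power_diff divide_inverse)
    then have "real (n choose (r - k)) * (?M * real (n choose k) + C * real n ^ (k - 1)) =
        u (r - k) n * (?M * u k n + C * inverse (real n)) * (real n ^ (r - k) * real n ^ k)"
      by (simp add: ch algebra_simps)
    also have "real n ^ (r - k) * real n ^ k = real n ^ r" using k by (simp flip: power_add)
    finally have rhs: "real (n choose (r - k)) * (?M * real (n choose k) + C * real n ^ (k - 1)) =
        u (r - k) n * (?M * u k n + C * inverse (real n)) * real n ^ r" .
    have upos: "0 < u r n" using npos n by (simp add: u_def)
    have "real (turan_number r n F) / real (n choose r) =
        real (turan_number r n F) * ?b\<^sup>2 / (?b\<^sup>2 * (u r n * real n ^ r))"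
      using bpos by (simp add: ch)
    also have "\<dots> \<le> u (r - k) n * (?M * u k n + C * inverse (real n)) * real n ^ r / (?b\<^sup>2 * (u r n * real n ^ r))"
      using le upos npos unfolding rhs by (intro divide_right_mono) auto
    also have "\<dots> = u (r - k) n * (?M * u k n + C * inverse (real n)) / (?b\<^sup>2 * u r n)"
      using npos by simp
    finally show "real (turan_number r n F) / real (n choose r) \<le>
        u (r - k) n * (?M * u k n + C * inverse (real n)) / (?b\<^sup>2 * u r n)" .
  qed
  then show ?thesis unfolding limit_eq .
qed

end
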